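(* Let $k\geqslant 1$ and let $\mathcal F_{k^\circ}$ be the set of strictly decreasing forests on $\{1<2<\dots<k<\circ\}$. Let $$\Sigma_k=\sum_{F\in\mathcal F_{k^\circ}}2^{l_F-1}\,B^{\ell_F(\circ)}\,X^*_{F_\circ}\prod_{T\in F^\dagger}X_T .$$ Then $$\Sigma_k=\sum_{P\in\mathrm{Dyck}(k)}C_P\,B^{D_{P,k}}\,X_1^{p_1}\cdots X_k^{p_k},$$ where $P=(p_1,\dots,p_k)$, $\mathrm{Dyck}(k)=\{P\in\mathbb{N}^k\mid\sum_{1\leqslant r\leqslant j}p_r\leqslant j\ \forall j\in\{1,\dots,k\}\}$, $D_{P,j}=j-\sum_{1\leqslant r\leqslant j}p_r$, and $$C_P=\prod_{j=1}^k\left[2\binom{D_{P,j-1}}{p_j-1}+\binom{D_{P,j-1}}{p_j}\right],$$ with the convention $\binom mn=0$ if $n\notin\{0,1,\dots,m\}$.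
   Context: A strictly decreasing forest $F$ on a finite totally ordered set $S$ is a partially defined function $F:S\to S$ such that $F(\nu)>\nu$ whenever $F(\nu)$ is defined. Elements of $S$ are nodes; nodes where $F$ is undefined are roots; a forest with exactly one root is a tree $T$, with root $\rho(T)$. The children of $\nu$ are the elements of $F^{-1}(\nu)$, and $\ell_F(\nu)$ (or $\ell(\nu)$) is their number. The subtree $F_\mu$ rooted at $\mu$ is the tree formed by the descendants $\nu$ of $\mu$ (those with $F^i(\nu)=\mu$ for some $i\geqslant0$). The trees of a forest are its subtrees rooted at roots of $F$; $l_F$ is their number (the number of roots of $F$). On $\{1<\dots<k<\circ\}$, the node $\circ$ is the maximum and hence always a root; $F^\dagger$ is the forest obtained from $F$ by removing the tree $F_\circ$, and $\prod_{T\in F^\dagger}$ runs over the trees of $F^\dagger$. Monomials: for a tree $T$ with nodes in $\{1,\dots,k\}$, $X_T=\prod_{\nu\in T}X_\nu^{\ell(\nu)+\delta_{\rho(T),\nu}}$ ($\delta$ the Kronecker symbol). For a tree $T$ put $X_T^*=\prod_{\nu\in T\setminus\{\rho(T)\}}X_\nu^{\ell(\nu)}$. Here $B^l$ and $X_\nu^l$ ($l\in\mathbb{N}$, $1\leqslant\nu\leqslant k$) are formal commuting symbols indexed by the exponent $l$; in particular $X_\nu^0$ need not be equal to $1$, nor need $B^0$ (each summand on either side contains exactly one symbol $B^l$ and, for each $\nu\in\{1,\dots,k\}$, exactly one symbol $X_\nu^l$). In particular the identity holds as an identity of polynomials in the indeterminates $B,X_1,\dots,X_k$. $\mathbb{N}=\{0,1,2,\dots\}$.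 *)

theory Defs
  imports Main "HOL-Library.FuncSet" "HOL-Library.Poly_Mapping"
begin

section \<open>Strictly decreasing forests\<close>

datatype 'a forest = Forest (nodes: "'a set") (parent: "'a \<rightharpoonup> 'a")

text \<open>The order along the partial map is increasing (a node lies below its parent);
  it decreases from the roots to the leaves.\<close>

definition strictly_decreasing_forest :: "'a::linorder forest \<Rightarrow> bool" where
  "strictly_decreasing_forest F \<longleftrightarrow>
     finite (nodes F) \<and> dom (parent F) \<subseteq> nodes F \<and> ran (parent F) \<subseteq> nodes F \<and>
     (\<forall>\<nu> \<mu>. parent F \<nu> = Some \<mu> \<longrightarrow> \<nu> < \<mu>)"

definition forests_on :: "'a::linorder set \<Rightarrow> 'a forest set" where
  "forests_on S = {F. strictly_decreasing_forest F \<and> nodes F = S}"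

definition roots :: "'a forest \<Rightarrow> 'a set" where
  "roots F = {\<nu> \<in> nodes F. parent F \<nu> = None}"

text \<open>Only meaningful for trees, that is, forests with exactly one root.\<close>

definition tree_root :: "'a forest \<Rightarrow> 'a" where
  "tree_root T = the_elem (roots T)"

definition children :: "'a forest \<Rightarrow> 'a \<Rightarrow> 'a set" where
  "children F \<nu> = {\<mu> \<in> nodes F. parent F \<mu> = Some \<nu>}"

definition num_children :: "'a forest \<Rightarrow> 'a \<Rightarrow> nat" where
  "num_children F \<nu> = card (children F \<nu>)"

definition iterate_parent :: "'a forest \<Rightarrow> nat \<Rightarrow> 'a \<Rightarrow> 'a option" where
  "iterate_parent F i \<nu> = ((\<lambda>z. Option.bind z (parent F)) ^^ i) (Some \<nu>)"

definition descendants :: "'a forest \<Rightarrow> 'a \<Rightarrow> 'a set" where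
  "descendants F \<mu> = {\<nu> \<in> nodes F. \<exists>i. iterate_parent F i \<nu> = Some \<mu>}"

definition subtree :: "'a forest \<Rightarrow> 'a \<Rightarrow> 'a forest" where
  "subtree F \<mu> = Forest (descendants F \<mu>) (parent F |` (descendants F \<mu> - {\<mu>}))"

definition trees :: "'a forest \<Rightarrow> 'a forest set" where
  "trees F = subtree F ` roots F"

definition num_trees :: "'a forest \<Rightarrow> nat" where
  "num_trees F = card (roots F)"

definition remove_tree :: "'a forest \<Rightarrow> 'a \<Rightarrow> 'a forest" where
  "remove_tree F \<mu> =
     Forest (nodes F - descendants F \<mu>) (parent F |` (nodes F - descendants F \<mu>))"

section \<open>The generating function of the forests\<close>

text \<open>The chain \<open>1 < \<dots> < k < \<circ>\<close> is realised as \<open>{1..Suc k}\<close>, with \<open>Suc k\<close> in the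
  role of the extra maximum \<open>\<circ>\<close>.\<close>

definition circ :: "nat \<Rightarrow> nat" where
  "circ k = Suc k"

definition forests_circ :: "nat \<Rightarrow> nat forest set" where
  "forests_circ k = forests_on ({1..k} \<union> {circ k})"

text \<open>Below, \<open>b l\<close> stands for the symbol \<open>B^l\<close> and \<open>x \<nu> l\<close> for the symbol \<open>X_\<nu>^l\<close>.
  No relation between the symbols for different \<open>l\<close> is built in; in particular
  \<open>b 0\<close> and \<open>x \<nu> 0\<close> need not be \<open>1\<close>.\<close>

definition tree_monomial :: "('v \<Rightarrow> nat \<Rightarrow> 'a::comm_monoid_mult) \<Rightarrow> 'v forest \<Rightarrow> 'a" where
  "tree_monomial x T =
     (\<Prod>\<nu>\<in>nodes T. x \<nu> (num_children T \<nu> + (if \<nu> = tree_root T then 1 else 0)))"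

definition tree_monomial_star :: "('v \<Rightarrow> nat \<Rightarrow> 'a::comm_monoid_mult) \<Rightarrow> 'v forest \<Rightarrow> 'a" where
  "tree_monomial_star x T = (\<Prod>\<nu>\<in>nodes T - {tree_root T}. x \<nu> (num_children T \<nu>))"

definition forest_sum ::
  "(nat \<Rightarrow> 'a::comm_semiring_1) \<Rightarrow> (nat \<Rightarrow> nat \<Rightarrow> 'a) \<Rightarrow> nat \<Rightarrow> 'a" where
  "forest_sum b x k =
     (\<Sum>F\<in>forests_circ k.
        2 ^ (num_trees F - 1) * b (num_children F (circ k)) *
        tree_monomial_star x (subtree F (circ k)) *
        (\<Prod>T\<in>trees (remove_tree F (circ k)). tree_monomial x T))"

section \<open>The generating function of the Dyck vectors\<close>

text \<open>A vector \<open>(p_1, \<dots>, p_k)\<close> is a function on \<open>{1..k}\<close>, extended by \<open>undefined\<close>.\<close>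

definition Dyck :: "nat \<Rightarrow> (nat \<Rightarrow> nat) set" where
  "Dyck k = {P \<in> {1..k} \<rightarrow>\<^sub>E UNIV. \<forall>j\<in>{1..k}. (\<Sum>r = 1..j. P r) \<le> j}"

definition Dyck_height :: "(nat \<Rightarrow> nat) \<Rightarrow> nat \<Rightarrow> int" where
  "Dyck_height P j = int j - (\<Sum>r = 1..j. int (P r))"

definition binom :: "int \<Rightarrow> int \<Rightarrow> nat" where
  "binom m n = (if 0 \<le> n \<and> n \<le> m then nat m choose nat n else 0)"

definition Dyck_coeff :: "nat \<Rightarrow> (nat \<Rightarrow> nat) \<Rightarrow> nat" where
  "Dyck_coeff k P =
     (\<Prod>j = 1..k. 2 * binom (Dyck_height P (j - 1)) (int (P j) - 1)
                  + binom (Dyck_height P (j - 1)) (int (P j)))"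

definition Dyck_sum ::
  "(nat \<Rightarrow> 'a::comm_semiring_1) \<Rightarrow> (nat \<Rightarrow> nat \<Rightarrow> 'a) \<Rightarrow> nat \<Rightarrow> 'a" where
  "Dyck_sum b x k =
     (\<Sum>P\<in>Dyck k. of_nat (Dyck_coeff k P) * b (nat (Dyck_height P k)) * (\<Prod>\<nu> = 1..k. x \<nu> (P \<nu>)))"

section \<open>Formal symbols\<close>

text \<open>Polynomials with integer coefficients in indeterminates of type \<open>'s\<close>: the inner finitely
  supported function gives the exponents of a monomial, the outer one the coefficients.\<close>

type_synonym 's int_mpoly = "('s \<Rightarrow>\<^sub>0 nat) \<Rightarrow>\<^sub>0 int"

definition indeterminate :: "'s \<Rightarrow> 's int_mpoly" where
  "indeterminate s = Poly_Mapping.single (Poly_Mapping.single s 1) 1"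

text \<open>One independent commuting symbol for each \<open>B^l\<close> and each \<open>X_\<nu>^l\<close>.\<close>

datatype power_symbol = B_pow nat | X_pow nat nat

text \<open>Ordinary indeterminates \<open>B, X_1, X_2, \<dots>\<close>, whose powers are genuine powers.\<close>

datatype variable_symbol = B_var | X_var nat

end

theory Submission
  imports Defs
begin

text \<open>Turn every root \<open>\<nu> \<le> k\<close> into a fixed point. A forest becomes a map \<open>g\<close> with
  \<open>\<nu> \<le> g \<nu> \<le> k + 1\<close>, a fixed point contributes a factor 2, and, because of the Kronecker
  symbol in \<open>X_T\<close>, the exponent of \<open>X_\<nu>\<close> is just the size of the fiber of \<open>g\<close> over \<open>\<nu>\<close>.
  Choose these fibers for \<open>j = 1, \<dots>, k\<close> in turn: \<open>D_{P,j-1}\<close> earlier points are not yet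
  assigned, and the fiber over \<open>j\<close>, of size \<open>p_j\<close>, either contains \<open>j\<close> (weight 2) or not,
  which gives the \<open>j\<close>-th factor of \<open>C_P\<close>. The \<open>D_{P,k}\<close> points left at the end are mapped
  to \<open>k + 1\<close>. Formally both sides satisfy one recurrence in \<open>k\<close>, in which the symbols \<open>b\<close>
  are replaced by a weighted sum; hence they have to be arbitrary in the induction.\<close>

section \<open>The monomial of a forest\<close>

lemma iterate_parent_0 [simp]: "iterate_parent F 0 \<nu> = Some \<nu>"
  by (simp add: iterate_parent_def)

text \<open>The definition has the last step outermost; here the first step is split off, so that a
  node can be compared with its parent. \<open>None\<close> is absorbing.\<close>

lemma iterate_parent_Suc:
  "iterate_parent F (Suc i) \<nu> = Option.bind (parent F \<nu>) (iterate_parent F i)"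
proof (cases "parent F \<nu>")
  case None
  have "((\<lambda>z. Option.bind z (parent F)) ^^ i) None = None"
    by (induction i) auto
  with None show ?thesis
    by (simp add: iterate_parent_def funpow_Suc_right del: funpow.simps)
next
  case (Some a)
  then show ?thesis
    by (simp add: iterate_parent_def funpow_Suc_right del: funpow.simps)
qed

lemma parent_in_nodes:
  assumes "strictly_decreasing_forest F" "parent F \<nu> = Some \<mu>"
  shows "\<nu> \<in> nodes F" "\<mu> \<in> nodes F" "\<nu> < \<mu>"
  using assms by (auto simp: strictly_decreasing_forest_def ran_def)

text \<open>From a root only the iterate with exponent 0 is defined.\<close>

lemma descendants_root_iff:
  assumes "\<nu> \<in> roots F"
  shows "\<nu> \<in> descendants F \<mu> \<longleftrightarrow> \<nu> = \<mu>"
proof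
  assume "\<nu> \<in> descendants F \<mu>"
  then obtain i where "iterate_parent F i \<nu> = Some \<mu>"
    by (auto simp: descendants_def)
  then show "\<nu> = \<mu>"
    using assms by (cases i) (auto simp: iterate_parent_Suc roots_def)
next
  assume "\<nu> = \<mu>"
  then show "\<nu> \<in> descendants F \<mu>"
    using assms by (auto simp: descendants_def roots_def intro: exI[of _ 0])
qed

text \<open>Paths from \<nu> and from its parent to \<mu> differ by the first step. As \<mu> is a
  root and \<nu> is not, the path from \<nu> cannot be empty.\<close>

lemma descendants_parent_iff:
  assumes "strictly_decreasing_forest F" "\<mu> \<in> roots F" "parent F \<nu> = Some \<nu>'"
  shows "\<nu> \<in> descendants F \<mu> \<longleftrightarrow> \<nu>' \<in> descendants F \<mu>"
proof
  assume "\<nu> \<in> descendants F \<mu>"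
  then obtain i where i: "iterate_parent F i \<nu> = Some \<mu>"
    by (auto simp: descendants_def)
  with assms obtain i' where "i = Suc i'"
    by (cases i) (auto simp: roots_def)
  with i assms show "\<nu>' \<in> descendants F \<mu>"
    by (auto simp: iterate_parent_Suc descendants_def dest: parent_in_nodes(2))
next
  assume "\<nu>' \<in> descendants F \<mu>"
  then obtain i where "iterate_parent F i \<nu>' = Some \<mu>"
    by (auto simp: descendants_def)
  then have "iterate_parent F (Suc i) \<nu> = Some \<mu>"
    using assms by (simp add: iterate_parent_Suc)
  then show "\<nu> \<in> descendants F \<mu>"
    unfolding descendants_def using parent_in_nodes(1)[OF assms(1,3)] by blast
qed

text \<open>Induction on the number of nodes above \<nu>, which drops at the parent: a node and its
  parent lie below the same roots, and a root lies only below itself.\<close>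

lemma ex1_root:
  fixes F :: "'a::linorder forest"
  assumes F: "strictly_decreasing_forest F" and "\<nu> \<in> nodes F"
  shows "\<exists>!\<mu>. \<mu> \<in> roots F \<and> \<nu> \<in> descendants F \<mu>"
  using \<open>\<nu> \<in> nodes F\<close>
proof (induction "card {\<kappa> \<in> nodes F. \<nu> < \<kappa>}" arbitrary: \<nu> rule: less_induct)
  case less
  show ?case
  proof (cases "parent F \<nu>")
    case None
    with less.prems have "\<nu> \<in> roots F"
      by (simp add: roots_def)
    then show ?thesis
      using descendants_root_iff[of \<nu> F] by (intro ex1I[of _ \<nu>]) simp_all
  next
    case (Some \<nu>')
    note \<nu>' = parent_in_nodes[OF F Some]
    have "{\<kappa> \<in> nodes F. \<nu>' < \<kappa>} \<subset> {\<kappa> \<in> nodes F. \<nu> < \<kappa>}"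
      using \<nu>' by (auto intro: less_trans)
    then have "card {\<kappa> \<in> nodes F. \<nu>' < \<kappa>} < card {\<kappa> \<in> nodes F. \<nu> < \<kappa>}"
      using F by (intro psubset_card_mono) (simp_all add: strictly_decreasing_forest_def)
    then have "\<exists>!\<mu>. \<mu> \<in> roots F \<and> \<nu>' \<in> descendants F \<mu>"
      using \<nu>'(2) by (rule less.hyps)
    moreover have "\<mu> \<in> roots F \<and> \<nu> \<in> descendants F \<mu> \<longleftrightarrow> \<mu> \<in> roots F \<and> \<nu>' \<in> descendants F \<mu>" for \<mu>
      using descendants_parent_iff[OF F _ Some] by blast
    ultimately show ?thesis
      by simp
  qed
qed

section \<open>Subtrees at roots and products over trees\<close>

lemma nodes_subtree [simp]: "nodes (subtree F \<mu>) = descendants F \<mu>"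
  by (simp add: subtree_def)

lemma tree_root_subtree:
  assumes F: "strictly_decreasing_forest F" and \<mu>: "\<mu> \<in> roots F"
  shows "tree_root (subtree F \<mu>) = \<mu>"
proof -
  have "\<nu> = \<mu>" if "\<nu> \<in> descendants F \<mu>" "parent F \<nu> = None" for \<nu>
    using that descendants_root_iff[of \<nu> F \<mu>] by (auto simp: roots_def descendants_def)
  then have "roots (subtree F \<mu>) = {\<mu>}"
    using descendants_root_iff[OF \<mu>]
    by (auto simp: roots_def subtree_def restrict_map_def split: if_splits)
  then show ?thesis
    by (simp add: tree_root_def)
qed

text \<open>A child of a descendant of \<mu> is again a descendant of \<mu>, so the restriction
  loses no child; \<mu> itself has no parent to lose.\<close>

lemma num_children_subtree:
  assumes F: "strictly_decreasing_forest F" and \<mu>: "\<mu> \<in> roots F" and "\<nu> \<in> descendants F \<mu>"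
  shows "num_children (subtree F \<mu>) \<nu> = num_children F \<nu>"
proof -
  have "children (subtree F \<mu>) \<nu> = children F \<nu>"
    using assms descendants_parent_iff[OF F \<mu>]
    by (auto simp: children_def subtree_def restrict_map_def roots_def descendants_def
        split: if_splits)
  then show ?thesis
    by (simp add: num_children_def)
qed

text \<open>The trees partition the nodes by \<open>ex1_root\<close>. Within one tree the only root
  of \<open>F\<close> is its own, so the Kronecker symbol becomes membership in
  \<open>roots F\<close>.\<close>

lemma prod_tree_monomial:
  assumes F: "strictly_decreasing_forest F"
  shows "(\<Prod>T\<in>trees F. tree_monomial x T) =
    (\<Prod>\<nu>\<in>nodes F. x \<nu> (num_children F \<nu> + (if \<nu> \<in> roots F then 1 else 0)))"
    (is "_ = prod ?w _")
proof -
  have fin: "finite (nodes F)"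
    using F by (simp add: strictly_decreasing_forest_def)
  have fin': "finite (roots F)"
    by (rule finite_subset[OF _ fin]) (auto simp: roots_def)
  \<comment> \<open>\<open>trees F\<close> is a set, so distinct roots must give distinct subtrees
    before the product can run over the roots.\<close>
  have inj: "inj_on (subtree F) (roots F)"
  proof (rule inj_onI)
    fix \<mu> \<mu>' assume *: "\<mu> \<in> roots F" "\<mu>' \<in> roots F" "subtree F \<mu> = subtree F \<mu>'"
    then have "descendants F \<mu> = descendants F \<mu>'"
      by (metis nodes_subtree)
    then show "\<mu> = \<mu>'"
      using descendants_root_iff[OF *(1)] by metis
  qed
  have "(\<Prod>T\<in>trees F. tree_monomial x T) = (\<Prod>\<mu>\<in>roots F. tree_monomial x (subtree F \<mu>))"
    unfolding trees_def by (simp add: prod.reindex[OF inj])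
  also have "\<dots> = (\<Prod>\<mu>\<in>roots F. prod ?w (descendants F \<mu>))"
  proof (rule prod.cong[OF refl])
    fix \<mu> assume \<mu>: "\<mu> \<in> roots F"
    have "\<nu> = \<mu> \<longleftrightarrow> \<nu> \<in> roots F" if "\<nu> \<in> descendants F \<mu>" for \<nu>
      using that \<mu> descendants_root_iff[of \<nu> F \<mu>] by metis
    then show "tree_monomial x (subtree F \<mu>) = prod ?w (descendants F \<mu>)"
      unfolding tree_monomial_def
      by (auto intro!: prod.cong simp: tree_root_subtree[OF F \<mu>] num_children_subtree[OF F \<mu>])
  qed
  also have "\<dots> = prod ?w (\<Union>\<mu>\<in>roots F. descendants F \<mu>)"
  proof (rule prod.UNION_disjoint[symmetric, OF fin'])
    show "\<forall>\<mu>\<in>roots F. finite (descendants F \<mu>)"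
      using fin by (auto simp: descendants_def)
    show "\<forall>\<mu>\<in>roots F. \<forall>\<mu>'\<in>roots F. \<mu> \<noteq> \<mu>' \<longrightarrow> descendants F \<mu> \<inter> descendants F \<mu>' = {}"
      using ex1_root[OF F] by (fastforce simp: descendants_def)
  qed
  also have "(\<Union>\<mu>\<in>roots F. descendants F \<mu>) = nodes F"
    using ex1_root[OF F] by (fastforce simp: descendants_def)
  finally show ?thesis .
qed

text \<open>The nodes outside the tree at \<mu> form a forest to which
  \<open>prod_tree_monomial\<close> applies. The starred monomial covers the descendants other than
  \<mu>, none of which is a root, so its exponents carry no extra 1.\<close>

lemma monomial_split_at_root:
  assumes F: "strictly_decreasing_forest F" and \<mu>: "\<mu> \<in> roots F"
  shows "tree_monomial_star x (subtree F \<mu>) * (\<Prod>T\<in>trees (remove_tree F \<mu>). tree_monomial x T) =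
    (\<Prod>\<nu>\<in>nodes F - {\<mu>}. x \<nu> (num_children F \<nu> + (if \<nu> \<in> roots F then 1 else 0)))"
    (is "_ = prod ?w _")
proof -
  define G where "G = remove_tree F \<mu>"
  have nodes_G: "nodes G = nodes F - descendants F \<mu>"
    by (simp add: G_def remove_tree_def)
  have parent_G: "parent G \<nu> = Some \<kappa> \<longleftrightarrow> parent F \<nu> = Some \<kappa> \<and> \<nu> \<in> nodes G" for \<nu> \<kappa>
    by (auto simp: nodes_G G_def remove_tree_def restrict_map_def split: if_splits)
  \<comment> \<open>A node and its parent lie on the same side, so removing the tree cuts no edge of
    the remaining forest.\<close>
  have step: "\<nu> \<in> nodes G \<longleftrightarrow> \<kappa> \<in> nodes G" if "parent F \<nu> = Some \<kappa>" for \<nu> \<kappa>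
    using parent_in_nodes[OF F that] descendants_parent_iff[OF F \<mu> that] by (auto simp: nodes_G)
  have fin: "finite (nodes F)"
    using F by (simp add: strictly_decreasing_forest_def)
  have G: "strictly_decreasing_forest G"
    unfolding strictly_decreasing_forest_def dom_def ran_def
    using step parent_in_nodes[OF F] fin by (auto simp: parent_G) (auto simp: nodes_G)
  have "num_children G \<nu> = num_children F \<nu>" if "\<nu> \<in> nodes G" for \<nu>
  proof -
    have "children G \<nu> = children F \<nu>"
      using that step by (auto simp: children_def parent_G) (auto simp: nodes_G)
    then show ?thesis by (simp add: num_children_def)
  qed
  moreover have "\<nu> \<in> roots G \<longleftrightarrow> \<nu> \<in> roots F" if "\<nu> \<in> nodes G" for \<nu>
    using that by (auto simp: roots_def nodes_G G_def remove_tree_def)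
  ultimately have "(\<Prod>T\<in>trees G. tree_monomial x T) = prod ?w (nodes G)"
    unfolding prod_tree_monomial[OF G] by (intro prod.cong) auto
  moreover have "tree_monomial_star x (subtree F \<mu>) = prod ?w (descendants F \<mu> - {\<mu>})"
    unfolding tree_monomial_star_def tree_root_subtree[OF F \<mu>] nodes_subtree
    by (intro prod.cong) (auto simp: num_children_subtree[OF F \<mu>] descendants_root_iff)
  moreover have "nodes F - {\<mu>} = (descendants F \<mu> - {\<mu>}) \<union> nodes G"
    using descendants_root_iff[OF \<mu>] by (auto simp: nodes_G descendants_def)
  moreover have "finite (descendants F \<mu>)" "finite (nodes G)" "(descendants F \<mu> - {\<mu>}) \<inter> nodes G = {}"
    using fin by (auto simp: nodes_G descendants_def)
  ultimately show ?thesis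
    by (simp add: G_def[symmetric] prod.union_disjoint)
qed

section \<open>Forests as functions with fixed points\<close>

definition forest_maps :: "nat \<Rightarrow> (nat \<Rightarrow> nat) set" where
  "forest_maps k = (\<Pi>\<^sub>E \<nu>\<in>{1..k}. {\<nu>..Suc k})"

definition fiber_card :: "nat \<Rightarrow> (nat \<Rightarrow> nat) \<Rightarrow> nat \<Rightarrow> nat" where
  "fiber_card k g \<nu> = card {\<mu> \<in> {1..k}. g \<mu> = \<nu>}"

text \<open>The maximum \<open>Suc k\<close> is not in the domain of \<open>g\<close>. Hence the
  fixed points are the roots other than \<open>Suc k\<close>, and their number is the number of
  trees minus 1.\<close>

definition forest_map_sum ::
  "(nat \<Rightarrow> 'a::comm_semiring_1) \<Rightarrow> (nat \<Rightarrow> nat \<Rightarrow> 'a) \<Rightarrow> nat \<Rightarrow> 'a" where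
  "forest_map_sum b x k =
     (\<Sum>g\<in>forest_maps k. 2 ^ card {\<nu> \<in> {1..k}. g \<nu> = \<nu>} * b (fiber_card k g (Suc k)) *
        (\<Prod>\<nu> = 1..k. x \<nu> (fiber_card k g \<nu>)))"

definition map_of_forest :: "nat \<Rightarrow> nat forest \<Rightarrow> nat \<Rightarrow> nat" where
  "map_of_forest k F = (\<lambda>\<nu>\<in>{1..k}. case parent F \<nu> of None \<Rightarrow> \<nu> | Some \<mu> \<Rightarrow> \<mu>)"

definition forest_of_map :: "nat \<Rightarrow> (nat \<Rightarrow> nat) \<Rightarrow> nat forest" where
  "forest_of_map k g =
     Forest {1..Suc k} (\<lambda>\<nu>. if \<nu> \<in> {1..k} \<and> g \<nu> \<noteq> \<nu> then Some (g \<nu>) else None)"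

section \<open>The bijection between forests and maps\<close>

lemma forests_circD:
  assumes "F \<in> forests_circ k"
  shows "strictly_decreasing_forest F" "nodes F = {1..Suc k}" "Suc k \<in> roots F"
    and "\<And>\<nu> \<mu>. parent F \<nu> = Some \<mu> \<Longrightarrow> 1 \<le> \<nu> \<and> \<nu> < \<mu> \<and> \<mu> \<le> Suc k"
proof -
  show F: "strictly_decreasing_forest F"
    using assms unfolding forests_circ_def forests_on_def by blast
  have "{1..k} \<union> {circ k} = {1..Suc k}"
    by (auto simp: circ_def)
  then show nodes: "nodes F = {1..Suc k}"
    using assms unfolding forests_circ_def forests_on_def by simp
  show *: "1 \<le> \<nu> \<and> \<nu> < \<mu> \<and> \<mu> \<le> Suc k" if "parent F \<nu> = Some \<mu>" for \<nu> \<mu>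
    using parent_in_nodes[OF F that] nodes by auto
  show "Suc k \<in> roots F"
    using *[of "Suc k"] nodes by (cases "parent F (Suc k)") (auto simp: roots_def)
qed

lemma forest_sum_eq_forest_map_sum: "forest_sum b x k = forest_map_sum b x k"
  unfolding forest_sum_def forest_map_sum_def
proof (rule sum.reindex_bij_witness[where i = "forest_of_map k" and j = "map_of_forest k"])
  fix F assume F: "F \<in> forests_circ k"
  note F' = forests_circD[OF F]
  define g where "g = map_of_forest k F"
  have parent_outside: "parent F \<nu> = None" if "\<nu> \<notin> {1..k}" for \<nu>
    using that F'(4)[of \<nu>] by (cases "parent F \<nu>") force+
  have g_fix: "g \<nu> = \<nu> \<longleftrightarrow> parent F \<nu> = None" if "\<nu> \<in> {1..k}" for \<nu>
    using that F'(4)[of \<nu>] by (auto simp: g_def map_of_forest_def split: option.splits)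
  have g_eq: "g \<mu> = \<nu> \<longleftrightarrow> parent F \<mu> = Some \<nu> \<or> parent F \<mu> = None \<and> \<mu> = \<nu>" if "\<mu> \<in> {1..k}" for \<mu> \<nu>
    using that by (auto simp: g_def map_of_forest_def split: option.splits)
  show "map_of_forest k F \<in> forest_maps k"
    using F'(4) by (fastforce simp: forest_maps_def map_of_forest_def split: option.splits)
  show "forest_of_map k (map_of_forest k F) = F"
  proof (rule forest.expand, intro conjI ext)
    show "nodes (forest_of_map k (map_of_forest k F)) = nodes F"
      using F'(2) by (simp add: forest_of_map_def)
    show "parent (forest_of_map k (map_of_forest k F)) \<nu> = parent F \<nu>" for \<nu>
      using parent_outside[of \<nu>] F'(4)[of \<nu>]
      by (cases "parent F \<nu>") (auto simp: forest_of_map_def map_of_forest_def)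
  qed
  have "roots F = insert (Suc k) {\<nu> \<in> {1..k}. g \<nu> = \<nu>}"
    using F'(2,3) g_fix by (auto simp: roots_def le_Suc_eq)
  then have roots: "num_trees F - 1 = card {\<nu> \<in> {1..k}. g \<nu> = \<nu>}"
    by (simp add: num_trees_def)
  have children: "fiber_card k g \<nu> = num_children F \<nu> + (if \<nu> \<in> roots F then 1 else 0)"
    if "\<nu> \<in> {1..k}" for \<nu>
  proof -
    \<comment> \<open>A root \<nu> at most \<open>k\<close> belongs to its own fiber, which produces
      the Kronecker summand.\<close>
    have "{\<mu> \<in> {1..k}. g \<mu> = \<nu>} = children F \<nu> \<union> (if \<nu> \<in> roots F then {\<nu>} else {})"
    proof (rule set_eqI)
      fix \<mu>
      show "\<mu> \<in> {\<mu> \<in> {1..k}. g \<mu> = \<nu>} \<longleftrightarrow>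
          \<mu> \<in> children F \<nu> \<union> (if \<nu> \<in> roots F then {\<nu>} else {})"
        using that F'(4)[of \<mu> \<nu>]
        by (cases "\<mu> \<in> {1..k}") (auto simp: children_def roots_def F'(2) g_eq)
    qed
    moreover have "finite (children F \<nu>)" "\<nu> \<notin> children F \<nu>"
      using F'(2,4) by (auto simp: children_def)
    ultimately show ?thesis
      by (simp add: fiber_card_def num_children_def)
  qed
  \<comment> \<open>Over \<open>Suc k\<close> the fiber consists of the children alone, since only
    points of \<open>{1..k}\<close> are counted.\<close>
  have "\<mu> \<in> {1..k} \<and> g \<mu> = Suc k \<longleftrightarrow> \<mu> \<in> children F (Suc k)" for \<mu>
    using F'(4)[of \<mu> "Suc k"]
    by (cases "\<mu> \<in> {1..k}") (auto simp: children_def F'(2) g_eq)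
  then have "{\<mu> \<in> {1..k}. g \<mu> = Suc k} = children F (Suc k)"
    by blast
  then have circ: "fiber_card k g (Suc k) = num_children F (circ k)"
    by (simp add: fiber_card_def num_children_def circ_def)
  have "nodes F - {circ k} = {1..k}"
    unfolding F'(2) circ_def by auto
  then have "tree_monomial_star x (subtree F (circ k)) *
      (\<Prod>T\<in>trees (remove_tree F (circ k)). tree_monomial x T) = (\<Prod>\<nu> = 1..k. x \<nu> (fiber_card k g \<nu>))"
    using monomial_split_at_root[OF F'(1), of "circ k" x] F'(3)
    by (simp add: children circ_def)
  with roots circ show "2 ^ card {\<nu> \<in> {1..k}. map_of_forest k F \<nu> = \<nu>} *
      b (fiber_card k (map_of_forest k F) (Suc k)) *
      (\<Prod>\<nu> = 1..k. x \<nu> (fiber_card k (map_of_forest k F) \<nu>)) =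
    2 ^ (num_trees F - 1) * b (num_children F (circ k)) *
      tree_monomial_star x (subtree F (circ k)) *
      (\<Prod>T\<in>trees (remove_tree F (circ k)). tree_monomial x T)"
    by (simp add: g_def mult.assoc)
next
  fix g assume g: "g \<in> forest_maps k"
  then have g': "\<nu> \<le> g \<nu>" "g \<nu> \<le> Suc k" if "\<nu> \<in> {1..k}" for \<nu>
    using that by (auto simp: forest_maps_def PiE_iff)
  show "map_of_forest k (forest_of_map k g) = g"
    using g by (auto simp: forest_maps_def map_of_forest_def forest_of_map_def PiE_iff
        extensional_def fun_eq_iff)
  have "1 \<le> \<nu> \<and> \<nu> < \<mu> \<and> \<mu> \<le> Suc k" if "parent (forest_of_map k g) \<nu> = Some \<mu>" for \<nu> \<mu>
    using that g'[of \<nu>] by (auto simp: forest_of_map_def split: if_splits)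
  moreover have "nodes (forest_of_map k g) = {1..k} \<union> {circ k}"
    by (auto simp: forest_of_map_def circ_def)
  ultimately show "forest_of_map k g \<in> forests_circ k"
    by (fastforce simp: forests_circ_def forests_on_def circ_def
        strictly_decreasing_forest_def dom_def ran_def)
qed

section \<open>The common recurrence\<close>

definition step_coeff :: "nat \<Rightarrow> nat \<Rightarrow> nat" where
  "step_coeff d p = 2 * binom (int d) (int p - 1) + binom (int d) (int p)"

text \<open>With \<open>d\<close> points still open, the new node adds one more; a fiber of size
  \<open>p\<close> is taken from these \<open>Suc d\<close> points, and the rest stay open.\<close>

definition step_weight ::
  "(nat \<Rightarrow> 'a::comm_semiring_1) \<Rightarrow> (nat \<Rightarrow> 'a) \<Rightarrow> nat \<Rightarrow> 'a" where
  "step_weight b y d = (\<Sum>p\<le>Suc d. of_nat (step_coeff d p) * y p * b (Suc d - p))"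

lemma sum_Pow_card:
  fixes f :: "nat \<Rightarrow> 'a::comm_semiring_1"
  assumes "finite A"
  shows "(\<Sum>U\<in>Pow A. f (card U)) = (\<Sum>p\<le>card A. of_nat (card A choose p) * f p)"
proof -
  have "(\<Sum>U\<in>Pow A. f (card U)) =
      (\<Sum>p\<le>card A. \<Sum>U\<in>{U \<in> Pow A. card U = p}. f (card U))"
    using assms by (intro sum.group[symmetric]) (auto intro: card_mono)
  also have "\<dots> = (\<Sum>p\<le>card A. of_nat (card A choose p) * f p)"
    using assms n_subsets[OF assms] by (intro sum.cong) (auto simp: Pow_def)
  finally show ?thesis .
qed

text \<open>Among the sets \<open>U\<close> of size \<open>p\<close>, those avoiding
  \<open>z\<close> number \<open>d\<close> choose \<open>p\<close>, those containing it
  \<open>d\<close> choose \<open>p - 1\<close>, where \<open>d\<close> is \<open>card A\<close>.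
  With weights 1 and 2 this is \<open>step_coeff d p\<close>.\<close>

lemma sum_Pow_insert_step_weight:
  assumes A: "finite A" and z: "z \<notin> A"
  shows "(\<Sum>U\<in>Pow (insert z A). (if z \<in> U then 2 else 1) * y (card U) * b (Suc (card A) - card U))
    = step_weight b y (card A)"
proof -
  let ?d = "card A"
  let ?f = "\<lambda>p. y p * b (Suc ?d - p)"
  \<comment> \<open>At \<open>p = 0\<close> the truncated \<open>p - 1\<close> would give the
    binomial coefficient 1, whereas \<open>binom\<close> vanishes at -1; hence the case
    distinction.\<close>
  have coeff: "of_nat (step_coeff ?d p) =
      of_nat (?d choose p) + 2 * (if p = 0 then 0 else of_nat (?d choose (p - 1)))" for p
    by (auto simp: step_coeff_def binom_def nat_diff_distrib binomial_eq_0 add.commute)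
  have inj: "inj_on (insert z) (Pow A)"
    using z by (auto simp: inj_on_def)
  have "(\<Sum>U\<in>Pow (insert z A). (if z \<in> U then 2 else 1) * y (card U) * b (Suc ?d - card U)) =
      (\<Sum>U\<in>Pow A. ?f (card U)) + (\<Sum>U\<in>Pow A. 2 * ?f (Suc (card U)))"
    unfolding Pow_insert
  proof (subst sum.union_disjoint)
    show "(\<Sum>U\<in>Pow A. (if z \<in> U then 2 else 1) * y (card U) * b (Suc ?d - card U)) +
        (\<Sum>U\<in>insert z ` Pow A. (if z \<in> U then 2 else 1) * y (card U) * b (Suc ?d - card U)) =
      (\<Sum>U\<in>Pow A. ?f (card U)) + (\<Sum>U\<in>Pow A. 2 * ?f (Suc (card U)))"
    proof (intro arg_cong2[where f = "(+)"])
      show "(\<Sum>U\<in>Pow A. (if z \<in> U then 2 else 1) * y (card U) * b (Suc ?d - card U)) =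
          (\<Sum>U\<in>Pow A. ?f (card U))"
        using z by (intro sum.cong) auto
      have "card (insert z U) = Suc (card U)" if "U \<in> Pow A" for U
        using that z A by (metis PowD card_insert_disjoint finite_subset in_mono)
      then show "(\<Sum>U\<in>insert z ` Pow A. (if z \<in> U then 2 else 1) * y (card U) * b (Suc ?d - card U)) =
          (\<Sum>U\<in>Pow A. 2 * ?f (Suc (card U)))"
        unfolding sum.reindex[OF inj] by (intro sum.cong) (auto simp: mult.assoc)
    qed
  qed (use A z in auto)
  also have "\<dots> = (\<Sum>p\<le>?d. of_nat (?d choose p) * ?f p) +
      (\<Sum>p\<le>?d. of_nat (?d choose p) * (2 * ?f (Suc p)))"
    unfolding sum_Pow_card[OF A, of ?f] sum_Pow_card[OF A, of "\<lambda>p. 2 * ?f (Suc p)"] ..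
  also have "\<dots> = step_weight b y ?d"
  proof -
    \<comment> \<open>Both sums are brought to the range up to \<open>Suc ?d\<close>: this one gains
      a zero term at the top, the other is shifted by one and gains a zero term at
      \<open>p = 0\<close>.\<close>
    have "(\<Sum>p\<le>?d. of_nat (?d choose p) * ?f p) = (\<Sum>p\<le>Suc ?d. of_nat (?d choose p) * ?f p)"
      by (simp add: binomial_eq_0)
    moreover have "(\<Sum>p\<le>?d. of_nat (?d choose p) * (2 * ?f (Suc p))) =
        (\<Sum>p\<le>Suc ?d. 2 * (if p = 0 then 0 else of_nat (?d choose (p - 1))) * ?f p)"
      unfolding sum.atMost_Suc_shift by (simp add: mult_ac)
    ultimately show ?thesis
      unfolding step_weight_def coeff by (simp only: distrib_right sum.distrib mult.assoc)
  qed
  finally show ?thesis .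
qed

text \<open>A map for \<open>Suc k\<close> is a map \<open>g\<close> for \<open>k\<close> together with the set of those points of
  \<open>g\<^sup>-\<^sup>1(Suc k) \<union> {Suc k}\<close> that stay at \<open>Suc k\<close>; all others move on to \<open>Suc (Suc k)\<close>.\<close>

lemma forest_map_sum_Suc: "forest_map_sum b x (Suc k) = forest_map_sum (step_weight b (x (Suc k))) x k"
proof -
  define A where "A g = {\<mu> \<in> {1..k}. g \<mu> = Suc k}" for g :: "nat \<Rightarrow> nat"
  define ext where "ext = (\<lambda>(g, U). \<lambda>\<nu>\<in>{1..Suc k}. if \<nu> \<in> U then Suc k
    else if \<nu> = Suc k \<or> g \<nu> = Suc k then Suc (Suc k) else g \<nu> :: nat)"
  \<comment> \<open>The minimum merges the values \<open>Suc k\<close> and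
    \<open>Suc (Suc k)\<close> and so recovers \<open>g\<close>; the fiber over \<open>Suc k\<close>
    recovers \<open>U\<close>.\<close>
  define cut where "cut h = (\<lambda>\<nu>\<in>{1..k}. min (h \<nu>) (Suc k), {\<nu> \<in> {1..Suc k}. h \<nu> = Suc k})"
    for h :: "nat \<Rightarrow> nat"
  \<comment> \<open>The part of the summand that depends on \<open>g\<close> alone: the choice of
    \<open>U\<close> does not affect fibers over points of \<open>{1..k}\<close>.\<close>
  define w where "w g = 2 ^ card {\<nu> \<in> {1..k}. g \<nu> = \<nu>} * (\<Prod>\<nu> = 1..k. x \<nu> (fiber_card k g \<nu>))" for g
  have "forest_map_sum b x (Suc k) = (\<Sum>(g, U)\<in>(SIGMA g:forest_maps k. Pow (insert (Suc k) (A g))).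
      w g * ((if Suc k \<in> U then 2 else 1) * x (Suc k) (card U) * b (Suc (card (A g)) - card U)))"
    unfolding forest_map_sum_def
  proof (rule sum.reindex_bij_witness[where i = ext and j = cut])
    fix h assume h: "h \<in> forest_maps (Suc k)"
    then have h_bounds: "\<nu> \<le> h \<nu>" "h \<nu> \<le> Suc (Suc k)" if "\<nu> \<in> {1..Suc k}" for \<nu>
      using that by (auto simp: forest_maps_def PiE_iff)
    have h_Suc: "h (Suc k) = Suc k \<or> h (Suc k) = Suc (Suc k)"
      using h_bounds[of "Suc k"] by auto
    show "ext (cut h) = h"
    proof
      fix \<nu>
      show "ext (cut h) \<nu> = h \<nu>"
      proof (cases "\<nu> \<in> {1..Suc k}")
        case True
        then show ?thesis
          using h_bounds[OF True] h_Suc by (auto simp: ext_def cut_def min_def le_Suc_eq)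
      next
        case False
        then have "h \<nu> = undefined"
          using h by (auto simp: forest_maps_def PiE_iff extensional_def)
        then show ?thesis
          using False by (auto simp: ext_def cut_def)
      qed
    qed
    obtain g U where gU: "cut h = (g, U)"
      by fastforce
    then have g: "g = (\<lambda>\<nu>\<in>{1..k}. min (h \<nu>) (Suc k))" and U: "U = {\<nu> \<in> {1..Suc k}. h \<nu> = Suc k}"
      by (auto simp: cut_def)
    have U_sub: "U \<subseteq> insert (Suc k) (A g)"
      by (auto simp: U A_def g le_Suc_eq)
    have "g \<in> forest_maps k"
      using h_bounds by (auto simp: forest_maps_def g)
    with U_sub show "cut h \<in> (SIGMA g:forest_maps k. Pow (insert (Suc k) (A g)))"
      by (simp add: gU)
    \<comment> \<open>The only possible new fixed point is \<open>Suc k\<close>, and it is one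
      exactly if it lies in \<open>U\<close>; this is the source of the weight 2.\<close>
    have "{\<nu> \<in> {1..Suc k}. h \<nu> = \<nu>} =
        {\<nu> \<in> {1..k}. g \<nu> = \<nu>} \<union> (if Suc k \<in> U then {Suc k} else {})"
      by (auto simp: g U le_Suc_eq min_def)
    then have fixpoints: "card {\<nu> \<in> {1..Suc k}. h \<nu> = \<nu>} =
        card {\<nu> \<in> {1..k}. g \<nu> = \<nu>} + (if Suc k \<in> U then 1 else 0)"
      by simp
    have "{\<mu> \<in> {1..Suc k}. h \<mu> = \<nu>} = {\<mu> \<in> {1..k}. g \<mu> = \<nu>}" if "\<nu> \<in> {1..k}" for \<nu>
      using that h_Suc by (auto simp: g le_Suc_eq min_def)
    then have fibers: "fiber_card (Suc k) h \<nu> = fiber_card k g \<nu>" if "\<nu> \<in> {1..k}" for \<nu>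
      using that by (simp add: fiber_card_def)
    have fiber_Suc: "fiber_card (Suc k) h (Suc k) = card U"
      by (simp add: fiber_card_def U)
    have "{\<mu> \<in> {1..Suc k}. h \<mu> = Suc (Suc k)} = insert (Suc k) (A g) - U"
    proof (rule set_eqI)
      fix \<mu>
      show "\<mu> \<in> {\<mu> \<in> {1..Suc k}. h \<mu> = Suc (Suc k)} \<longleftrightarrow> \<mu> \<in> insert (Suc k) (A g) - U"
        using h_bounds[of \<mu>] h_Suc by (auto simp: g U A_def min_def le_Suc_eq)
    qed
    moreover have "finite U" "finite (A g)" "Suc k \<notin> A g"
      by (auto simp: U A_def)
    ultimately have fiber_circ: "fiber_card (Suc k) h (Suc (Suc k)) = Suc (card (A g)) - card U"
      using U_sub by (simp add: fiber_card_def card_Diff_subset)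
    show "(case cut h of (g, U) \<Rightarrow>
        w g * ((if Suc k \<in> U then 2 else 1) * x (Suc k) (card U) * b (Suc (card (A g)) - card U))) =
      2 ^ card {\<nu> \<in> {1..Suc k}. h \<nu> = \<nu>} * b (fiber_card (Suc k) h (Suc (Suc k))) *
        (\<Prod>\<nu> = 1..Suc k. x \<nu> (fiber_card (Suc k) h \<nu>))"
      unfolding gU fixpoints fiber_circ
      by (simp add: w_def fibers fiber_Suc mult_ac)
  next
    fix gU assume gU: "gU \<in> (SIGMA g:forest_maps k. Pow (insert (Suc k) (A g)))"
    then obtain g U where gU_eq: "gU = (g, U)" and g: "g \<in> forest_maps k"
      and U: "U \<subseteq> insert (Suc k) (A g)"
      by auto
    have g_bounds: "\<nu> \<le> g \<nu>" "g \<nu> \<le> Suc k" if "\<nu> \<in> {1..k}" for \<nu>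
      using that g by (auto simp: forest_maps_def PiE_iff)
    have U_bounds: "\<nu> \<le> Suc k" "1 \<le> \<nu>" "\<nu> \<noteq> Suc k \<longrightarrow> g \<nu> = Suc k" if "\<nu> \<in> U" for \<nu>
      using that U by (auto simp: A_def)
    show "ext gU \<in> forest_maps (Suc k)"
      using g_bounds by (force simp: gU_eq ext_def forest_maps_def le_Suc_eq)
    have "min (ext gU \<nu>) (Suc k) = g \<nu>" if "\<nu> \<in> {1..k}" for \<nu>
      using that g_bounds[OF that] U_bounds[of \<nu>] by (auto simp: gU_eq ext_def)
    moreover have "g \<nu> = undefined" if "\<nu> \<notin> {1..k}" for \<nu>
      using that g by (auto simp: forest_maps_def PiE_iff extensional_def)
    ultimately have "(\<lambda>\<nu>\<in>{1..k}. min (ext gU \<nu>) (Suc k)) = g"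
      by (auto simp: fun_eq_iff)
    moreover have "{\<nu> \<in> {1..Suc k}. ext gU \<nu> = Suc k} = U"
      using U_bounds by (auto simp: gU_eq ext_def split: if_splits)
    ultimately show "cut (ext gU) = gU"
      by (simp add: cut_def gU_eq)
  qed
  \<comment> \<open>The sum over \<open>U\<close> depends on \<open>g\<close> only through
    \<open>card (A g)\<close>, the size of its fiber over \<open>Suc k\<close>, which is the index
    of \<open>b\<close> in the sum for \<open>k\<close>.\<close>
  also have "\<dots> = (\<Sum>g\<in>forest_maps k. w g * step_weight b (x (Suc k)) (card (A g)))"
    by (subst sum.Sigma[symmetric])
       (auto simp: forest_maps_def A_def finite_PiE sum_distrib_left[symmetric]
         sum_Pow_insert_step_weight)
  also have "\<dots> = forest_map_sum (step_weight b (x (Suc k))) x k"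
    by (simp add: forest_map_sum_def w_def A_def fiber_card_def mult_ac)
  finally show ?thesis .
qed

section \<open>The recurrence for Dyck vectors\<close>

lemma Dyck_height_0 [simp]: "Dyck_height P 0 = 0"
  by (simp add: Dyck_height_def)

lemma Dyck_height_Suc: "Dyck_height P (Suc k) = Dyck_height P k + 1 - int (P (Suc k))"
  by (simp add: Dyck_height_def)

lemma Dyck_height_cong:
  assumes "\<And>r. r \<in> {1..j} \<Longrightarrow> P r = Q r"
  shows "Dyck_height P j = Dyck_height Q j"
  using assms by (simp add: Dyck_height_def)

lemma mem_Dyck_iff: "P \<in> Dyck k \<longleftrightarrow> P \<in> extensional {1..k} \<and> (\<forall>j\<in>{1..k}. 0 \<le> Dyck_height P j)"
proof -
  have "0 \<le> Dyck_height P j \<longleftrightarrow> (\<Sum>r = 1..j. P r) \<le> j" for j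
    unfolding Dyck_height_def of_nat_sum[symmetric] by linarith
  then show ?thesis
    by (auto simp: Dyck_def PiE_iff)
qed

text \<open>The Dyck condition starts at index 1; for \<open>k = 0\<close> the height is 0.\<close>

lemma Dyck_height_nonneg: "P \<in> Dyck k \<Longrightarrow> 0 \<le> Dyck_height P k"
  by (cases k) (auto simp: mem_Dyck_iff)

text \<open>Each entry is at most its partial sum, hence at most \<open>k\<close>.\<close>

lemma finite_Dyck: "finite (Dyck k)"
proof (rule finite_subset)
  show "Dyck k \<subseteq> ({1..k} \<rightarrow>\<^sub>E {..k})"
  proof
    fix P assume P: "P \<in> Dyck k"
    have "P j \<le> k" if "j \<in> {1..k}" for j
    proof -
      have "P j \<le> (\<Sum>r = 1..j. P r)"
        using that by (intro member_le_sum) auto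
      also have "\<dots> \<le> j"
        using P that by (auto simp: Dyck_def)
      finally show ?thesis using that by simp
    qed
    with P show "P \<in> ({1..k} \<rightarrow>\<^sub>E {..k})"
      by (auto simp: Dyck_def PiE_iff)
  qed
qed (simp add: finite_PiE)

text \<open>Split off the last entry \<open>p\<close>. The new condition says that the height plus 1
  minus \<open>p\<close> is nonnegative, which is the range of summation in
  \<open>step_weight\<close>; the new factor of the coefficient is
  \<open>step_coeff\<close>.\<close>

lemma Dyck_sum_Suc: "Dyck_sum b x (Suc k) = Dyck_sum (step_weight b (x (Suc k))) x k"
proof -
  let ?h = "\<lambda>P. nat (Dyck_height P k)"
  define w where "w P = of_nat (Dyck_coeff k P) * (\<Prod>\<nu> = 1..k. x \<nu> (P \<nu>))" for P
  have "Dyck_sum b x (Suc k) = (\<Sum>(P, p)\<in>(SIGMA P:Dyck k. {..Suc (?h P)}).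
      w P * (of_nat (step_coeff (?h P) p) * x (Suc k) p * b (Suc (?h P) - p)))"
    unfolding Dyck_sum_def
  proof (rule sum.reindex_bij_witness[where i = "\<lambda>(P, p). P(Suc k := p)"
        and j = "\<lambda>Q. (restrict Q {1..k}, Q (Suc k))"])
    fix Q assume Q: "Q \<in> Dyck (Suc k)"
    define P where "P = restrict Q {1..k}"
    have P_eq: "P j = Q j" if "j \<in> {1..k}" for j
      using that by (simp add: P_def)
    have h: "Dyck_height P j = Dyck_height Q j" if "j \<le> k" for j
      using that by (intro Dyck_height_cong) (simp add: P_def)
    have P: "P \<in> Dyck k"
      using Q h by (auto simp: mem_Dyck_iff) (simp add: P_def)
    have h_nonneg: "0 \<le> Dyck_height Q k"
      using Dyck_height_nonneg[OF P] h by simp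
    have "0 \<le> Dyck_height Q (Suc k)"
      using Q by (rule Dyck_height_nonneg)
    then have p: "Q (Suc k) \<le> Suc (?h P)"
      using h_nonneg by (simp add: h Dyck_height_Suc)
    show "(case (restrict Q {1..k}, Q (Suc k)) of (P, p) \<Rightarrow> P(Suc k := p)) = Q"
      using Q by (auto simp: fun_eq_iff mem_Dyck_iff extensional_def le_Suc_eq)
    show "(restrict Q {1..k}, Q (Suc k)) \<in> (SIGMA P:Dyck k. {..Suc (?h P)})"
      using P p by (simp add: P_def)
    have "Dyck_coeff k P = Dyck_coeff k Q"
      unfolding Dyck_coeff_def by (intro prod.cong) (auto simp: h P_eq)
    \<comment> \<open>\<open>step_coeff\<close> takes a natural number, so the height at
      \<open>k\<close> has to be nonnegative for \<open>nat\<close> to preserve it.\<close>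
    then have "Dyck_coeff (Suc k) Q = Dyck_coeff k P * step_coeff (?h P) (Q (Suc k))"
      using h_nonneg by (simp add: Dyck_coeff_def step_coeff_def h)
    moreover have "nat (Dyck_height Q (Suc k)) = Suc (?h P) - Q (Suc k)"
      using h_nonneg by (simp add: h Dyck_height_Suc)
    moreover have "(\<Prod>\<nu> = 1..Suc k. x \<nu> (Q \<nu>)) = (\<Prod>\<nu> = 1..k. x \<nu> (P \<nu>)) * x (Suc k) (Q (Suc k))"
      by (simp add: P_def)
    ultimately show "(case (restrict Q {1..k}, Q (Suc k)) of (P, p) \<Rightarrow>
        w P * (of_nat (step_coeff (?h P) p) * x (Suc k) p * b (Suc (?h P) - p))) =
      of_nat (Dyck_coeff (Suc k) Q) * b (nat (Dyck_height Q (Suc k))) *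
        (\<Prod>\<nu> = 1..Suc k. x \<nu> (Q \<nu>))"
      unfolding P_def[symmetric] by (simp add: w_def mult_ac)
  next
    fix Pp assume "Pp \<in> (SIGMA P:Dyck k. {..Suc (?h P)})"
    then obtain P p where Pp: "Pp = (P, p)" and P: "P \<in> Dyck k" and p: "p \<le> Suc (?h P)"
      by auto
    let ?Q = "P(Suc k := p)"
    have h: "Dyck_height ?Q j = Dyck_height P j" if "j \<le> k" for j
      using that by (intro Dyck_height_cong) auto
    have "0 \<le> Dyck_height ?Q (Suc k)"
      using p Dyck_height_nonneg[OF P] by (simp add: Dyck_height_Suc h)
    then show "(case Pp of (P, p) \<Rightarrow> P(Suc k := p)) \<in> Dyck (Suc k)"
      using P h by (auto simp: Pp mem_Dyck_iff extensional_def le_Suc_eq)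
    have "restrict ?Q {1..k} = P"
      using P by (auto simp: fun_eq_iff mem_Dyck_iff extensional_def)
    then show "(restrict (case Pp of (P, p) \<Rightarrow> P(Suc k := p)) {1..k},
        (case Pp of (P, p) \<Rightarrow> P(Suc k := p)) (Suc k)) = Pp"
      by (simp add: Pp)
  qed
  also have "\<dots> = (\<Sum>P\<in>Dyck k. w P * step_weight b (x (Suc k)) (?h P))"
    by (subst sum.Sigma[symmetric])
       (auto simp: finite_Dyck step_weight_def sum_distrib_left simp del: sum.atMost_Suc)
  also have "\<dots> = Dyck_sum (step_weight b (x (Suc k))) x k"
    by (simp add: Dyck_sum_def w_def mult_ac)
  finally show ?thesis .
qed

lemma forest_map_sum_eq_Dyck_sum: "forest_map_sum b x k = Dyck_sum b x k"
proof (induction k arbitrary: b)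
  case 0
  \<comment> \<open>Each sum has a single term, equal to \<open>b 0\<close>.\<close>
  then show ?case
    by (simp add: forest_map_sum_def Dyck_sum_def forest_maps_def Dyck_def fiber_card_def
        Dyck_height_def Dyck_coeff_def)
next
  case (Suc k)
  then show ?case
    by (simp only: forest_map_sum_Suc Dyck_sum_Suc)
qed

theorem theorem2:
  fixes k :: nat
  assumes "k \<ge> 1"
  shows "forest_sum (\<lambda>l. indeterminate (B_pow l)) (\<lambda>\<nu> l. indeterminate (X_pow \<nu> l)) k
           = Dyck_sum (\<lambda>l. indeterminate (B_pow l)) (\<lambda>\<nu> l. indeterminate (X_pow \<nu> l)) k
       \<and> forest_sum (\<lambda>l. indeterminate B_var ^ l) (\<lambda>\<nu> l. indeterminate (X_var \<nu>) ^ l) k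
           = Dyck_sum (\<lambda>l. indeterminate B_var ^ l) (\<lambda>\<nu> l. indeterminate (X_var \<nu>) ^ l) k"
  \<comment> \<open>Both parts are instances of one identity for arbitrary families \<open>b\<close>
    and \<open>x\<close> in a commutative semiring.\<close>
  by (simp only: forest_sum_eq_forest_map_sum forest_map_sum_eq_Dyck_sum simp_thms)

end
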